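(* Let $(\Omega,M)$ be a finite transformation monoid and let $\nu$ be a probability distribution on $\Omega$. Suppose that $\mu$ is a probability distribution on $M$ such that the submonoid $N=\langle\mathrm{supp}(\mu)\rangle$ is transitive on $\Omega$. Let $P$ be the transition matrix of the irreducible Markov chain with state set $\Omega$ defined by $$P(\alpha,\beta)=\sum_{m\in M,\ \alpha m=\beta}\mu(m)\qquad(\alpha,\beta\in\Omega),$$ and let $\pi$ be the stationary distribution of $P$. If $f\colon\Omega\to\mathbb R$ is a function such that $E_\nu(mf)=E_\nu(f)$ for all $m\in N$, then $E_\pi(f)=E_\nu(f)$.
   Context: A transformation monoid $(\Omega,M)$ is a non-empty set $\Omega$ with a submonoid $M$ of the monoid of all self-maps of $\Omega$, acting on the right; it is finite if $\Omega$ is finite. A submonoid $N$ is transitive on $\Omega$ if $\alpha N=\Omega$ for all $\alpha\in\Omega$. $\langle A\rangle$ denotes the submonoid of $M$ generated by $A$. A probability distribution on a finite set $X$ is a function $\mu\colon X\to[0,1]$ with $\sum_{x\in X}\mu(x)=1$; $\mathrm{supp}(\mu)=\{x\mid\mu(x)\neq0\}$. For $f\colon\Omega\to\mathbb R$ and a distribution $\theta$ on $\Omega$, $E_\theta(f)=\sum_{\omega\in\Omega}f(\omega)\theta(\omega)$. For $m\in M$, the function $mf$ is defined by $(mf)(\omega)=f(\omega m)$. A distribution $\pi$ on $\Omega$ is stationary for $P$ if $\pi P=\pi$, where $(\pi P)(\alpha)=\sum_{\omega\in\Omega}\pi(\omega)P(\omega,\alpha)$. Since $N$ is transitive, the chain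 is irreducible and has a unique stationary distribution. *)

theory Defs
  imports "HOL-Probability.Probability" "HOL-Algebra.Group"
begin

text \<open>
  A self-map of \<open>\<Omega>\<close> is an extensional function in \<open>\<Omega> \<rightarrow>\<^sub>E \<Omega>\<close>, so that equality of functions is
  equality on \<open>\<Omega>\<close>. Maps act on the right: the point \<open>\<alpha>m\<close> is \<open>m \<alpha>\<close>, and the product \<open>mn\<close> applies
  \<open>m\<close> first.
\<close>

definition full_transformation_monoid :: "'a set \<Rightarrow> ('a \<Rightarrow> 'a) monoid"
  where "full_transformation_monoid \<Omega> =
    \<lparr>carrier = \<Omega> \<rightarrow>\<^sub>E \<Omega>, monoid.mult = (\<lambda>m n. compose \<Omega> n m), one = (\<lambda>\<omega>\<in>\<Omega>. \<omega>)\<rparr>"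

lemma monoid_full_transformation_monoid: "monoid (full_transformation_monoid \<Omega>)"
  unfolding full_transformation_monoid_def
  by (rule monoidI) (auto simp: compose_def fun_eq_iff PiE_iff extensional_def)

definition transformation_monoid :: "'a set \<Rightarrow> ('a \<Rightarrow> 'a) set \<Rightarrow> bool"
  where "transformation_monoid \<Omega> M \<longleftrightarrow>
    \<Omega> \<noteq> {} \<and> submonoid M (full_transformation_monoid \<Omega>)"

definition generated_submonoid :: "('a, 'b) monoid_scheme \<Rightarrow> 'a set \<Rightarrow> 'a set"
  where "generated_submonoid G A = (\<lambda>H. submonoid H G) hull A"

definition transitive_on :: "'a set \<Rightarrow> ('a \<Rightarrow> 'a) set \<Rightarrow> bool"
  where "transitive_on \<Omega> N \<longleftrightarrow> (\<forall>\<alpha>\<in>\<Omega>. (\<lambda>m. m \<alpha>) ` N = \<Omega>)"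

text \<open>
  A probability distribution on a finite set \<open>X\<close> is a \<open>pmf\<close> \<open>\<theta>\<close> with \<open>set_pmf \<theta> \<subseteq> X\<close>; its support is
  \<open>set_pmf \<theta>\<close>. For such \<open>\<theta>\<close>, \<open>measure_pmf.expectation \<theta> f\<close> is the finite sum of \<open>f x * pmf \<theta> x\<close>
  over \<open>x \<in> X\<close>, and only the values of \<open>f\<close> on \<open>X\<close> matter.
\<close>

definition distribution_on :: "'a set \<Rightarrow> 'a pmf \<Rightarrow> bool"
  where "distribution_on X \<theta> \<longleftrightarrow> set_pmf \<theta> \<subseteq> X"

definition act_fun :: "('a \<Rightarrow> 'a) \<Rightarrow> ('a \<Rightarrow> real) \<Rightarrow> 'a \<Rightarrow> real"
  where "act_fun m f = (\<lambda>\<omega>. f (m \<omega>))"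

definition transition_matrix :: "('a \<Rightarrow> 'a) set \<Rightarrow> ('a \<Rightarrow> 'a) pmf \<Rightarrow> 'a \<Rightarrow> 'a \<Rightarrow> real"
  where "transition_matrix M \<mu> \<alpha> \<beta> = (\<Sum>m\<in>{m \<in> M. m \<alpha> = \<beta>}. pmf \<mu> m)"

definition stationary_distribution :: "'a set \<Rightarrow> ('a \<Rightarrow> 'a \<Rightarrow> real) \<Rightarrow> 'a pmf \<Rightarrow> bool"
  where "stationary_distribution \<Omega> P \<pi> \<longleftrightarrow>
    distribution_on \<Omega> \<pi> \<and> (\<forall>\<alpha>\<in>\<Omega>. (\<Sum>\<omega>\<in>\<Omega>. pmf \<pi> \<omega> * P \<omega> \<alpha>) = pmf \<pi> \<alpha>)"

end

theory Submission
  imports Defs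
begin

text \<open>
  The distribution \<open>\<mu>\<close> averages functions on \<open>\<Omega>\<close>: let \<open>T h\<close> take the value \<open>\<Sum>m. \<mu>(m) h(\<alpha>m)\<close> at
  \<open>\<alpha>\<close>, so that \<open>T\<close> is the transition matrix \<open>P\<close> acting on column vectors. Two linear functionals
  keep a constant value along the orbit \<open>f, T f, T\<^sup>2 f, \<dots>\<close>. One is \<open>E\<^sub>\<pi>\<close>, because \<open>\<pi>\<close> is stationary
  (\<open>expectation_averaging_stationary\<close>). The other is \<open>E\<^sub>\<nu>\<close>, because the hypothesis that \<open>E\<^sub>\<nu>(mf)\<close> is
  the same number for all \<open>m \<in> N\<close> passes from \<open>f\<close> to \<open>T f\<close>: the function \<open>m(T f)\<close>
  is the average of the functions \<open>(mn)f\<close> with weights \<open>\<mu>(n)\<close>, and \<open>mn \<in> N\<close> (\<open>expectation_act_averaging\<close>).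

  The averages of \<open>f, T f, \<dots>, T\<^sup>n f\<close> are bounded, hence accumulate at some function \<open>h\<close> on the finite
  set \<open>\<Omega>\<close>, and \<open>T h = h\<close> because consecutive terms telescope (\<open>harmonic_limit_of_averages\<close>). The two
  functionals have the same values at \<open>h\<close> as at \<open>f\<close>. By the maximum principle and transitivity,
  \<open>h\<close> is constant (\<open>harmonic_constant\<close>). Every probability distribution gives a constant function the
  same expectation, so \<open>E\<^sub>\<pi>(f) = E\<^sub>\<pi>(h) = E\<^sub>\<nu>(h) = E\<^sub>\<nu>(f)\<close>.
\<close>

section \<open>Expectations on finite sets\<close>

lemma expectation_finite_sum:
  fixes f :: "'a \<Rightarrow> real"
  assumes "finite A" "set_pmf \<theta> \<subseteq> A"
  shows "measure_pmf.expectation \<theta> f = (\<Sum>x\<in>A. f x * pmf \<theta> x)"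
  using assms by (intro integral_measure_pmf_real) auto

lemma expectation_cong_support:
  fixes f g :: "'a \<Rightarrow> real"
  assumes "\<And>x. x \<in> set_pmf \<theta> \<Longrightarrow> f x = g x"
  shows "measure_pmf.expectation \<theta> f = measure_pmf.expectation \<theta> g"
  using assms by (intro integral_cong_AE) (auto simp: AE_measure_pmf_iff)

lemma expectation_swap:
  fixes F :: "'a \<Rightarrow> 'b \<Rightarrow> real"
  assumes "finite (set_pmf p)" "finite (set_pmf q)"
  shows "measure_pmf.expectation p (\<lambda>x. measure_pmf.expectation q (F x)) =
    measure_pmf.expectation q (\<lambda>y. measure_pmf.expectation p (\<lambda>x. F x y))"
  unfolding expectation_finite_sum[OF assms(1) order_refl]
    expectation_finite_sum[OF assms(2) order_refl] sum_distrib_right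
  by (subst sum.swap) (simp only: mult_ac)

lemma expectation_tendsto:
  fixes u :: "nat \<Rightarrow> 'a \<Rightarrow> real"
  assumes "finite (set_pmf \<theta>)" "\<And>x. x \<in> set_pmf \<theta> \<Longrightarrow> (\<lambda>n. u n x) \<longlonglongrightarrow> h x"
  shows "(\<lambda>n. measure_pmf.expectation \<theta> (u n)) \<longlonglongrightarrow> measure_pmf.expectation \<theta> h"
  unfolding expectation_finite_sum[OF assms(1) order_refl]
  by (intro tendsto_sum tendsto_mult tendsto_const assms(2))

lemma expectation_abs_le:
  fixes f :: "'a \<Rightarrow> real"
  assumes "finite (set_pmf \<theta>)" "\<And>x. x \<in> set_pmf \<theta> \<Longrightarrow> \<bar>f x\<bar> \<le> B"
  shows "\<bar>measure_pmf.expectation \<theta> f\<bar> \<le> B"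
proof -
  have "\<bar>measure_pmf.expectation \<theta> f\<bar> \<le> measure_pmf.expectation \<theta> (\<lambda>x. \<bar>f x\<bar>)"
    by (rule integral_abs_bound)
  also have "\<dots> \<le> measure_pmf.expectation \<theta> (\<lambda>_. B)"
    using assms by (intro integral_mono_AE integrable_measure_pmf_finite)
      (auto simp: AE_measure_pmf_iff)
  finally show ?thesis by simp
qed

lemma expectation_attains_bound:
  fixes f :: "'a \<Rightarrow> real"
  assumes "finite (set_pmf \<theta>)" "\<And>x. x \<in> set_pmf \<theta> \<Longrightarrow> f x \<le> B"
    and "measure_pmf.expectation \<theta> f = B" and "x \<in> set_pmf \<theta>"
  shows "f x = B"
proof -
  have "measure_pmf.expectation \<theta> (\<lambda>x. B - f x) = 0"
    using assms by (simp add: integrable_measure_pmf_finite)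
  then have "(\<Sum>x\<in>set_pmf \<theta>. (B - f x) * pmf \<theta> x) = 0"
    by (simp add: expectation_finite_sum[OF assms(1) order_refl])
  then have "(B - f x) * pmf \<theta> x = 0"
    using assms by (subst (asm) sum_nonneg_eq_0_iff) auto
  with assms(4) show ?thesis by (simp add: set_pmf_iff)
qed

lemma convergent_subsequence_finite_family:
  fixes u :: "nat \<Rightarrow> 'a \<Rightarrow> real"
  assumes "finite S" "\<And>x. x \<in> S \<Longrightarrow> Bseq (\<lambda>n. u n x)"
  shows "\<exists>r. strict_mono r \<and> (\<forall>x\<in>S. convergent (\<lambda>n. u (r n) x))"
  using assms
proof (induction S rule: finite_induct)
  case empty
  then show ?case by (auto intro: strict_mono_id)
next
  case (insert a S)
  then obtain r where r: "strict_mono r" "\<forall>x\<in>S. convergent (\<lambda>n. u (r n) x)"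
    by auto
  have "Bseq (\<lambda>n. u (r n) a)"
    using insert.prems[of a] Bseq_subseq[of "\<lambda>n. u n a" r] by simp
  then have "bounded (range (\<lambda>n. u (r n) a))"
    by (auto simp: Bseq_def bounded_iff)
  then obtain l s where s: "strict_mono s" "((\<lambda>n. u (r n) a) \<circ> s) \<longlonglongrightarrow> l"
    using bounded_imp_convergent_subsequence[of "\<lambda>n. u (r n) a"] by blast
  have "convergent (\<lambda>n. u (r (s n)) x)" if "x \<in> insert a S" for x
  proof (cases "x = a")
    case True
    then show ?thesis using s by (auto simp: convergent_def o_def)
  next
    case False
    then have "convergent (\<lambda>n. u (r n) x)" using that r by auto
    from convergent_subseq_convergent[OF this s(1)] show ?thesis by (simp add: o_def)
  qed
  then show ?case
    using strict_mono_o[OF r(1) s(1)] by (intro exI[of _ "r \<circ> s"]) (simp add: o_def)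
qed

section \<open>The averaging operator of a distribution on maps\<close>

text \<open>
  This is the transition matrix as an operator on functions. Summing over maps instead of over
  target states makes its interplay with the action of the monoid visible.
\<close>

definition averaging :: "('a \<Rightarrow> 'a) pmf \<Rightarrow> ('a \<Rightarrow> real) \<Rightarrow> 'a \<Rightarrow> real"
  where "averaging \<mu> h = (\<lambda>\<alpha>. measure_pmf.expectation \<mu> (\<lambda>m. h (m \<alpha>)))"

lemma averaging_power_bounded:
  assumes "finite (set_pmf \<mu>)" "\<And>m \<alpha>. m \<in> set_pmf \<mu> \<Longrightarrow> \<alpha> \<in> \<Omega> \<Longrightarrow> m \<alpha> \<in> \<Omega>"
    and "\<And>\<alpha>. \<alpha> \<in> \<Omega> \<Longrightarrow> \<bar>f \<alpha>\<bar> \<le> B" and "\<alpha> \<in> \<Omega>"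
  shows "\<bar>(averaging \<mu> ^^ k) f \<alpha>\<bar> \<le> B"
  using assms(4)
proof (induction k arbitrary: \<alpha>)
  case 0
  then show ?case using assms by simp
next
  case (Suc k)
  then show ?case using assms
    by (simp add: averaging_def[of _ "(averaging \<mu> ^^ k) f"] expectation_abs_le)
qed

text \<open>
  This is the mean ergodic theorem in the weak form of a subsequence limit. The last clause says
  that every functional \<open>E\<^sub>\<theta>\<close> which is constant along the orbit of \<open>f\<close> keeps its value at the limit.
\<close>

lemma harmonic_limit_of_averages:
  assumes "finite \<Omega>" "finite (set_pmf \<mu>)"
    and maps: "\<And>m \<alpha>. m \<in> set_pmf \<mu> \<Longrightarrow> \<alpha> \<in> \<Omega> \<Longrightarrow> m \<alpha> \<in> \<Omega>"
  obtains h where "\<And>\<alpha>. \<alpha> \<in> \<Omega> \<Longrightarrow> averaging \<mu> h \<alpha> = h \<alpha>"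
    and "\<And>\<theta> c. set_pmf \<theta> \<subseteq> \<Omega> \<Longrightarrow>
      (\<And>k. measure_pmf.expectation \<theta> ((averaging \<mu> ^^ k) f) = c) \<Longrightarrow>
      measure_pmf.expectation \<theta> h = c"
proof -
  define g where "g k = (averaging \<mu> ^^ k) f" for k
  define u where "u n = (\<lambda>\<alpha>. (\<Sum>k<Suc n. g k \<alpha>) / real (Suc n))" for n
  define B where "B = (\<Sum>\<alpha>\<in>\<Omega>. \<bar>f \<alpha>\<bar>)"
  have gB: "\<bar>g k \<alpha>\<bar> \<le> B" if "\<alpha> \<in> \<Omega>" for k \<alpha>
    unfolding g_def using assms that
    by (intro averaging_power_bounded[of \<mu> \<Omega>]) (auto simp: B_def intro!: member_le_sum)
  have uB: "\<bar>u n \<alpha>\<bar> \<le> B" if "\<alpha> \<in> \<Omega>" for n \<alpha>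
  proof -
    have "\<bar>\<Sum>k<Suc n. g k \<alpha>\<bar> \<le> (\<Sum>k<Suc n. \<bar>g k \<alpha>\<bar>)" by (rule sum_abs)
    also have "\<dots> \<le> (\<Sum>k<Suc n. B)" by (intro sum_mono gB that)
    finally show ?thesis
      by (simp only: u_def abs_divide) (simp add: divide_le_eq mult.commute)
  qed
  have "\<exists>r. strict_mono r \<and> (\<forall>\<alpha>\<in>\<Omega>. convergent (\<lambda>n. u (r n) \<alpha>))"
    using assms(1) uB by (intro convergent_subsequence_finite_family) (auto intro!: BseqI')
  then obtain r where r: "strict_mono r" and "\<forall>\<alpha>\<in>\<Omega>. convergent (\<lambda>n. u (r n) \<alpha>)"
    by blast
  then obtain h where h: "\<And>\<alpha>. \<alpha> \<in> \<Omega> \<Longrightarrow> (\<lambda>n. u (r n) \<alpha>) \<longlonglongrightarrow> h \<alpha>"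
    unfolding convergent_def by metis
  have telescope: "averaging \<mu> (u n) \<alpha> = u n \<alpha> + (g (Suc n) \<alpha> - g 0 \<alpha>) / real (Suc n)" for n \<alpha>
  proof -
    have "averaging \<mu> (u n) \<alpha> =
        measure_pmf.expectation \<mu> (\<lambda>m. \<Sum>k<Suc n. g k (m \<alpha>)) / real (Suc n)"
      unfolding u_def averaging_def by (rule integral_divide_zero)
    also have "measure_pmf.expectation \<mu> (\<lambda>m. \<Sum>k<Suc n. g k (m \<alpha>)) = (\<Sum>k<Suc n. g (Suc k) \<alpha>)"
      using assms(2) by (subst Bochner_Integration.integral_sum)
        (auto simp only: g_def funpow.simps o_apply averaging_def
          intro: integrable_measure_pmf_finite)
    also have "(\<Sum>k<Suc n. g (Suc k) \<alpha>) = (\<Sum>k<Suc n. g k \<alpha>) + (g (Suc n) \<alpha> - g 0 \<alpha>)"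
      using sum_lessThan_telescope[of "\<lambda>k. g k \<alpha>" "Suc n"]
      by (simp only: sum_subtractf algebra_simps)
    finally show ?thesis by (simp only: u_def add_divide_distrib)
  qed
  show ?thesis
  proof
    fix \<alpha> assume \<alpha>: "\<alpha> \<in> \<Omega>"
    have "(\<lambda>n. averaging \<mu> (u (r n)) \<alpha>) \<longlonglongrightarrow> averaging \<mu> h \<alpha>"
      unfolding averaging_def using assms(2) \<alpha> maps by (auto intro!: expectation_tendsto h)
    moreover have "(\<lambda>n. averaging \<mu> (u (r n)) \<alpha>) \<longlonglongrightarrow> h \<alpha> + 0"
      unfolding telescope
    proof (intro tendsto_add h \<alpha>)
      have "(\<lambda>n. (g (Suc n) \<alpha> - g 0 \<alpha>) * inverse (real (Suc n))) \<longlonglongrightarrow> 0"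
      proof (rule lim_null_mult_left_bounded[where B = "2 * B"])
        show "eventually (\<lambda>n. norm (g (Suc n) \<alpha> - g 0 \<alpha>) \<le> 2 * B) sequentially"
          using gB[OF \<alpha>, of 0] gB[OF \<alpha>] by (intro always_eventually allI) (smt (verit) real_norm_def)
        show "(\<lambda>n. inverse (real (Suc n))) \<longlonglongrightarrow> 0" by (rule LIMSEQ_inverse_real_of_nat)
      qed
      then show "(\<lambda>n. (g (Suc (r n)) \<alpha> - g 0 \<alpha>) / real (Suc (r n))) \<longlonglongrightarrow> 0"
        using LIMSEQ_subseq_LIMSEQ[OF _ r] by (simp add: o_def divide_inverse)
    qed
    ultimately show "averaging \<mu> h \<alpha> = h \<alpha>"
      using LIMSEQ_unique by fastforce
  next
    fix \<theta> :: "'a pmf" and c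
    assume \<theta>: "set_pmf \<theta> \<subseteq> \<Omega>"
      and c: "\<And>k. measure_pmf.expectation \<theta> ((averaging \<mu> ^^ k) f) = c"
    have fin: "finite (set_pmf \<theta>)" using \<theta> assms(1) finite_subset by blast
    have "measure_pmf.expectation \<theta> (u n) = c" for n
      using fin c unfolding u_def
      by (simp del: sum.lessThan_Suc of_nat_Suc
          add: integrable_measure_pmf_finite Bochner_Integration.integral_sum g_def)
    moreover have "(\<lambda>n. measure_pmf.expectation \<theta> (u (r n))) \<longlonglongrightarrow> measure_pmf.expectation \<theta> h"
      using \<theta> by (intro expectation_tendsto fin h) auto
    ultimately show "measure_pmf.expectation \<theta> h = c"
      by (simp add: LIMSEQ_const_iff)
  qed
qed

lemma averaging_eq_transition_matrix:
  assumes "finite \<Omega>" "finite M" "set_pmf \<mu> \<subseteq> M" "\<And>m. m \<in> M \<Longrightarrow> m \<alpha> \<in> \<Omega>"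
  shows "averaging \<mu> h \<alpha> = (\<Sum>\<beta>\<in>\<Omega>. transition_matrix M \<mu> \<alpha> \<beta> * h \<beta>)"
proof -
  have "averaging \<mu> h \<alpha> = (\<Sum>m\<in>M. h (m \<alpha>) * pmf \<mu> m)"
    using assms by (simp add: averaging_def expectation_finite_sum[of M])
  also have "\<dots> = (\<Sum>\<beta>\<in>\<Omega>. \<Sum>m\<in>{m\<in>M. m \<alpha> = \<beta>}. h (m \<alpha>) * pmf \<mu> m)"
    using assms by (intro sum.group[symmetric]) auto
  also have "\<dots> = (\<Sum>\<beta>\<in>\<Omega>. transition_matrix M \<mu> \<alpha> \<beta> * h \<beta>)"
    by (auto simp: transition_matrix_def sum_distrib_left mult.commute intro!: sum.cong)
  finally show ?thesis .
qed

lemma expectation_averaging_stationary: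
  assumes "finite \<Omega>" "finite M" "set_pmf \<mu> \<subseteq> M" "\<And>m \<alpha>. m \<in> M \<Longrightarrow> \<alpha> \<in> \<Omega> \<Longrightarrow> m \<alpha> \<in> \<Omega>"
    and "stationary_distribution \<Omega> (transition_matrix M \<mu>) \<pi>"
  shows "measure_pmf.expectation \<pi> (averaging \<mu> h) = measure_pmf.expectation \<pi> h"
proof -
  let ?P = "transition_matrix M \<mu>"
  have \<pi>: "set_pmf \<pi> \<subseteq> \<Omega>" and st: "\<And>\<beta>. \<beta> \<in> \<Omega> \<Longrightarrow> (\<Sum>\<alpha>\<in>\<Omega>. pmf \<pi> \<alpha> * ?P \<alpha> \<beta>) = pmf \<pi> \<beta>"
    using assms(5) by (auto simp: stationary_distribution_def distribution_on_def)
  have "measure_pmf.expectation \<pi> (averaging \<mu> h)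
      = (\<Sum>\<alpha>\<in>\<Omega>. (\<Sum>\<beta>\<in>\<Omega>. ?P \<alpha> \<beta> * h \<beta>) * pmf \<pi> \<alpha>)"
    using assms \<pi>
    by (simp add: expectation_finite_sum[of \<Omega>] averaging_eq_transition_matrix[of \<Omega> M])
  also have "\<dots> = (\<Sum>\<beta>\<in>\<Omega>. h \<beta> * (\<Sum>\<alpha>\<in>\<Omega>. pmf \<pi> \<alpha> * ?P \<alpha> \<beta>))"
    unfolding sum_distrib_left sum_distrib_right
    by (subst sum.swap) (simp only: mult_ac)
  also have "\<dots> = measure_pmf.expectation \<pi> h"
    using assms(1) \<pi> by (simp add: st expectation_finite_sum[of \<Omega>])
  finally show ?thesis .
qed

section \<open>Generated transformation monoids\<close>

lemma generated_submonoid_superset: "A \<subseteq> generated_submonoid G A"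
  unfolding generated_submonoid_def by (rule hull_subset)

lemma generated_submonoid_least:
  "submonoid H G \<Longrightarrow> A \<subseteq> H \<Longrightarrow> generated_submonoid G A \<subseteq> H"
  unfolding generated_submonoid_def by (rule hull_minimal)

lemma generated_submonoid_one: "\<one>\<^bsub>G\<^esub> \<in> generated_submonoid G A"
  unfolding generated_submonoid_def hull_def by (auto intro: submonoid.one_closed)

lemma generated_submonoid_mult:
  "x \<in> generated_submonoid G A \<Longrightarrow> y \<in> generated_submonoid G A \<Longrightarrow>
    x \<otimes>\<^bsub>G\<^esub> y \<in> generated_submonoid G A"
  unfolding generated_submonoid_def hull_def by (auto intro: submonoid.m_closed)

lemma transformation_monoid_maps:
  assumes "transformation_monoid \<Omega> M"
  shows "M \<subseteq> \<Omega> \<rightarrow>\<^sub>E \<Omega>" "(\<lambda>\<omega>\<in>\<Omega>. \<omega>) \<in> M"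
    "\<And>m n. m \<in> M \<Longrightarrow> n \<in> M \<Longrightarrow> compose \<Omega> n m \<in> M"
  using assms
  by (auto simp: transformation_monoid_def full_transformation_monoid_def submonoid_def)

text \<open>
  The maximum principle: an average of values that do not exceed the maximum attains it only if
  every value in the support does. Hence the set of maximum points is stable under the support,
  and so under the monoid that it generates, which moves one maximum point to every other point.
\<close>

lemma harmonic_constant:
  assumes M: "transformation_monoid \<Omega> M" and "finite \<Omega>"
    and \<mu>: "finite (set_pmf \<mu>)" "set_pmf \<mu> \<subseteq> M"
    and trans: "transitive_on \<Omega>
      (generated_submonoid ((full_transformation_monoid \<Omega>)\<lparr>carrier := M\<rparr>) (set_pmf \<mu>))"
    and harmonic: "\<And>\<alpha>. \<alpha> \<in> \<Omega> \<Longrightarrow> averaging \<mu> h \<alpha> = h \<alpha>"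
  shows "\<exists>c. \<forall>\<alpha>\<in>\<Omega>. h \<alpha> = c"
proof -
  let ?G = "(full_transformation_monoid \<Omega>)\<lparr>carrier := M\<rparr>"
  note mapsM = transformation_monoid_maps[OF M]
  have "\<Omega> \<noteq> {}" using M by (simp add: transformation_monoid_def)
  define c where "c = Max (h ` \<Omega>)"
  have le: "h \<alpha> \<le> c" if "\<alpha> \<in> \<Omega>" for \<alpha>
    using that \<open>finite \<Omega>\<close> by (simp add: c_def)
  have "c \<in> h ` \<Omega>"
    unfolding c_def using \<open>finite \<Omega>\<close> \<open>\<Omega> \<noteq> {}\<close> by (intro Max_in) auto
  then obtain a where a: "a \<in> \<Omega>" "h a = c" by auto
  define H where "H = {m \<in> M. \<forall>\<alpha>\<in>\<Omega>. h \<alpha> = c \<longrightarrow> h (m \<alpha>) = c}"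
  have "submonoid H ?G"
  proof
    show "H \<subseteq> carrier ?G" by (auto simp: H_def)
    show "\<one>\<^bsub>?G\<^esub> \<in> H"
      using mapsM by (auto simp: H_def full_transformation_monoid_def)
    show "m \<otimes>\<^bsub>?G\<^esub> n \<in> H" if "m \<in> H" "n \<in> H" for m n
    proof -
      have "m \<alpha> \<in> \<Omega>" if "\<alpha> \<in> \<Omega>" for \<alpha>
        using \<open>m \<in> H\<close> mapsM(1) that by (auto simp: H_def)
      then show ?thesis
        using that mapsM(3) by (auto simp: H_def full_transformation_monoid_def compose_eq)
    qed
  qed
  moreover have "set_pmf \<mu> \<subseteq> H"
  proof
    fix m assume m: "m \<in> set_pmf \<mu>"
    have "h (m \<alpha>) = c" if "\<alpha> \<in> \<Omega>" "h \<alpha> = c" for \<alpha>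
    proof (rule expectation_attains_bound[OF \<mu>(1) _ _ m])
      show "h (n \<alpha>) \<le> c" if "n \<in> set_pmf \<mu>" for n
        using that \<open>\<alpha> \<in> \<Omega>\<close> \<mu> mapsM(1) by (intro le) auto
      show "measure_pmf.expectation \<mu> (\<lambda>n. h (n \<alpha>)) = c"
        using harmonic that by (simp add: averaging_def)
    qed
    then show "m \<in> H" using m \<mu> by (auto simp: H_def)
  qed
  ultimately have N_H: "generated_submonoid ?G (set_pmf \<mu>) \<subseteq> H"
    by (rule generated_submonoid_least)
  have "h \<alpha> = c" if "\<alpha> \<in> \<Omega>" for \<alpha>
  proof -
    have "\<alpha> \<in> (\<lambda>m. m a) ` generated_submonoid ?G (set_pmf \<mu>)"
      using trans a(1) that by (simp add: transitive_on_def)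
    then obtain m where "m \<in> H" "\<alpha> = m a" using N_H by blast
    then show ?thesis using a by (simp add: H_def)
  qed
  then show ?thesis by blast
qed

text \<open>
  The hypothesis ranges over all of \<open>N\<close> so that the conclusion has the same form and can be iterated.
  Invariance under the support of \<open>\<mu>\<close> alone would not pass from \<open>f\<close> to its average.
\<close>

lemma expectation_act_averaging:
  assumes "finite (set_pmf \<nu>)" "finite (set_pmf \<mu>)" "set_pmf \<nu> \<subseteq> \<Omega>" "set_pmf \<mu> \<subseteq> N"
    and mult: "\<And>m n. m \<in> N \<Longrightarrow> n \<in> N \<Longrightarrow> compose \<Omega> n m \<in> N"
    and c: "\<And>m. m \<in> N \<Longrightarrow> measure_pmf.expectation \<nu> (act_fun m f) = c" and "m \<in> N"
  shows "measure_pmf.expectation \<nu> (act_fun m (averaging \<mu> f)) = c"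
proof -
  have "measure_pmf.expectation \<nu> (act_fun m (averaging \<mu> f)) =
      measure_pmf.expectation \<mu> (\<lambda>n. measure_pmf.expectation \<nu> (\<lambda>\<omega>. f (n (m \<omega>))))"
    unfolding act_fun_def averaging_def using assms by (intro expectation_swap)
  also have "\<dots> = measure_pmf.expectation \<mu> (\<lambda>n. c)"
  proof (rule expectation_cong_support)
    fix n assume "n \<in> set_pmf \<mu>"
    then have "compose \<Omega> n m \<in> N" using assms by auto
    moreover have "measure_pmf.expectation \<nu> (\<lambda>\<omega>. f (n (m \<omega>))) =
        measure_pmf.expectation \<nu> (act_fun (compose \<Omega> n m) f)"
      using assms(3) by (intro expectation_cong_support) (auto simp: act_fun_def compose_eq)
    ultimately show "measure_pmf.expectation \<nu> (\<lambda>\<omega>. f (n (m \<omega>))) = c" by (simp add: c)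
  qed
  finally show ?thesis by simp
qed

section \<open>Equality of the two expectations\<close>

theorem theorem10p2:
  fixes \<Omega> :: "'a set" and M N :: "('a \<Rightarrow> 'a) set"
    and \<nu> \<pi> :: "'a pmf" and \<mu> :: "('a \<Rightarrow> 'a) pmf"
    and P :: "'a \<Rightarrow> 'a \<Rightarrow> real" and f :: "'a \<Rightarrow> real"
  assumes "transformation_monoid \<Omega> M" and "finite \<Omega>"
    and "distribution_on \<Omega> \<nu>"
    and "distribution_on M \<mu>"
    and "N = generated_submonoid ((full_transformation_monoid \<Omega>)\<lparr>carrier := M\<rparr>) (set_pmf \<mu>)"
    and "transitive_on \<Omega> N"
    and "P = transition_matrix M \<mu>"
    and "stationary_distribution \<Omega> P \<pi>"
    and "\<And>m. m \<in> N \<Longrightarrow>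
      measure_pmf.expectation \<nu> (act_fun m f) = measure_pmf.expectation \<nu> f"
  shows "measure_pmf.expectation \<pi> f = measure_pmf.expectation \<nu> f"
proof -
  let ?G = "(full_transformation_monoid \<Omega>)\<lparr>carrier := M\<rparr>"
  let ?c = "measure_pmf.expectation \<nu> f"
  note mapsM = transformation_monoid_maps[OF assms(1)]
  have \<nu>: "set_pmf \<nu> \<subseteq> \<Omega>" and \<pi>: "set_pmf \<pi> \<subseteq> \<Omega>" and \<mu>: "set_pmf \<mu> \<subseteq> M"
    using assms(3,4,8) by (auto simp: distribution_on_def stationary_distribution_def)
  have "finite M"
    using mapsM(1) assms(2) by (meson finite_PiE finite_subset)
  then have fin\<mu>: "finite (set_pmf \<mu>)" using \<mu> finite_subset by blast
  have fin\<nu>: "finite (set_pmf \<nu>)" using \<nu> assms(2) finite_subset by blast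
  have oneN: "(\<lambda>\<omega>\<in>\<Omega>. \<omega>) \<in> N"
    using generated_submonoid_one[of ?G "set_pmf \<mu>"] assms(5)
    by (simp add: full_transformation_monoid_def)
  have multN: "compose \<Omega> n m \<in> N" if "m \<in> N" "n \<in> N" for m n
    using generated_submonoid_mult[of m ?G "set_pmf \<mu>" n] assms(5) that
    by (simp add: full_transformation_monoid_def)
  have suppN: "set_pmf \<mu> \<subseteq> N" unfolding assms(5) by (rule generated_submonoid_superset)
  obtain h where harmonic: "\<And>\<alpha>. \<alpha> \<in> \<Omega> \<Longrightarrow> averaging \<mu> h \<alpha> = h \<alpha>"
    and limit: "\<And>\<theta> c. set_pmf \<theta> \<subseteq> \<Omega> \<Longrightarrow>
      (\<And>k. measure_pmf.expectation \<theta> ((averaging \<mu> ^^ k) f) = c) \<Longrightarrow>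
      measure_pmf.expectation \<theta> h = c"
    using harmonic_limit_of_averages[of \<Omega> \<mu> f] assms(2) fin\<mu> \<mu> mapsM(1) by blast
  have \<pi>_orbit: "measure_pmf.expectation \<pi> ((averaging \<mu> ^^ k) f) = measure_pmf.expectation \<pi> f" for k
  proof (induction k)
    case (Suc k)
    have "measure_pmf.expectation \<pi> (averaging \<mu> ((averaging \<mu> ^^ k) f)) =
        measure_pmf.expectation \<pi> ((averaging \<mu> ^^ k) f)"
      by (rule expectation_averaging_stationary[of \<Omega> M])
        (use assms(2,7,8) \<open>finite M\<close> \<mu> mapsM(1) in auto)
    with Suc show ?case by simp
  qed simp
  have act_orbit: "measure_pmf.expectation \<nu> (act_fun m ((averaging \<mu> ^^ k) f)) = ?c"
    if "m \<in> N" for m k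
    using that
  proof (induction k arbitrary: m)
    case 0
    then show ?case using assms(9) by simp
  next
    case (Suc k)
    then show ?case
      using expectation_act_averaging[OF fin\<nu> fin\<mu> \<nu> suppN multN, where c = ?c] by simp
  qed
  have \<nu>_orbit: "measure_pmf.expectation \<nu> ((averaging \<mu> ^^ k) f) = ?c" for k
  proof -
    have "measure_pmf.expectation \<nu> ((averaging \<mu> ^^ k) f) =
        measure_pmf.expectation \<nu> (act_fun (\<lambda>\<omega>\<in>\<Omega>. \<omega>) ((averaging \<mu> ^^ k) f))"
      using \<nu> by (intro expectation_cong_support) (auto simp: act_fun_def)
    then show ?thesis using act_orbit[OF oneN] by simp
  qed
  obtain d where d: "\<forall>\<alpha>\<in>\<Omega>. h \<alpha> = d"
    using harmonic_constant[OF assms(1,2) fin\<mu> \<mu> _ harmonic] assms(5,6) by blast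
  have const: "measure_pmf.expectation \<theta> h = d" if "set_pmf \<theta> \<subseteq> \<Omega>" for \<theta>
  proof -
    have "measure_pmf.expectation \<theta> h = measure_pmf.expectation \<theta> (\<lambda>_. d)"
      using d that by (intro expectation_cong_support) auto
    then show ?thesis by simp
  qed
  have "measure_pmf.expectation \<pi> f = d"
    using limit[OF \<pi> \<pi>_orbit] const[OF \<pi>] by simp
  also have "d = ?c"
    using limit[OF \<nu> \<nu>_orbit] const[OF \<nu>] by simp
  finally show ?thesis .
qed

end
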